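(* For every $r\ge 3$ and $t\ge 2$, \[ \pi(\mathcal D_{r,t+1})\le 1-\frac1t-\frac{1}{12t^2}. \]
   Context: An $r$-graph is a collection of $r$-element subsets (edges) of a finite vertex set. For a family/graph $\mathcal F$ of $r$-graphs, an $r$-graph is $\mathcal F$-free if it contains no member of $\mathcal F$ as a (not necessarily induced) subgraph; $\operatorname{ex}(n,\mathcal F)$ is the maximum number of edges of an $\mathcal F$-free $r$-graph on $n$ vertices, and the Turán density is $\pi(\mathcal F)=\lim_{n\to\infty}\operatorname{ex}(n,\mathcal F)/\binom nr$ (this limit exists). For a graph $F$, its $r$-suspension is the $r$-graph obtained by adding a fixed set $S$ of $r-2$ new vertices to every edge of $F$, i.e. with edges $e\cup S$ for $e\in E(F)$. The $(r,t)$-daisy $\mathcal D_{r,t}$ is the $r$-suspension of the complete graph $K_t$. *)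

theory Defs
  imports Complex_Main
begin

type_synonym 'a hypergraph = "'a set \<times> 'a set set"

abbreviation verts :: "'a hypergraph \<Rightarrow> 'a set" where
  "verts G \<equiv> fst G"

abbreviation edges :: "'a hypergraph \<Rightarrow> 'a set set" where
  "edges G \<equiv> snd G"

definition rgraph :: "nat \<Rightarrow> 'a hypergraph \<Rightarrow> bool" where
  "rgraph r G \<longleftrightarrow> finite (verts G) \<and> (\<forall>e\<in>edges G. e \<subseteq> verts G \<and> card e = r)"

text \<open>Containment as a not necessarily induced subgraph, up to isomorphism.\<close>

definition contains :: "'a hypergraph \<Rightarrow> 'b hypergraph \<Rightarrow> bool" where
  "contains G F \<longleftrightarrow>
     (\<exists>f. inj_on f (verts F) \<and> f ` verts F \<subseteq> verts G \<and> (\<forall>e\<in>edges F. f ` e \<in> edges G))"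

definition free_of :: "'b hypergraph set \<Rightarrow> 'a hypergraph \<Rightarrow> bool" where
  "free_of \<F> G \<longleftrightarrow> (\<forall>F\<in>\<F>. \<not> contains G F)"

text \<open>
  The vertex set is taken to be \<open>{..<n}\<close>, which loses nothing since \<^const>\<open>free_of\<close> is
  invariant under relabelling. The maximum is over a finite set, nonempty as soon as every
  member of the family has an edge.
\<close>

definition ex_num :: "nat \<Rightarrow> nat \<Rightarrow> 'b hypergraph set \<Rightarrow> nat" where
  "ex_num r n \<F> =
     Max {card (edges G) | G :: nat hypergraph.
            rgraph r G \<and> verts G = {..<n} \<and> free_of \<F> G}"

definition turan_density :: "nat \<Rightarrow> 'b hypergraph set \<Rightarrow> real" where
  "turan_density r \<F> = lim (\<lambda>n. real (ex_num r n \<F>) / real (n choose r))"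

definition complete_graph :: "nat \<Rightarrow> nat hypergraph" where
  "complete_graph t = ({..<t}, {e. e \<subseteq> {..<t} \<and> card e = 2})"

text \<open>The \<open>r - 2\<close> new vertices are \<open>Inr ` {..<r - 2}\<close>; meant for \<open>r \<ge> 2\<close>.\<close>

definition suspension :: "nat \<Rightarrow> 'a hypergraph \<Rightarrow> ('a + nat) hypergraph" where
  "suspension r F =
     (Inl ` verts F \<union> Inr ` {..<r - 2}, (\<lambda>e. Inl ` e \<union> Inr ` {..<r - 2}) ` edges F)"

definition daisy :: "nat \<Rightarrow> nat \<Rightarrow> (nat + nat) hypergraph" where
  "daisy r t = suspension r (complete_graph t)"

end

theory Submission
  imports Defs
begin

text \<open>
  Passing to links of \<open>(r - 3)\<close>-sets reduces the problem to \<open>r = 3\<close>, where the link of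
  every vertex is \<open>K\<^bsub>t+1\<^esub>\<close>-free. Colour the non-edges blue; the blue density is
  \<open>1/t + \<epsilon>\<close> with \<open>\<epsilon> \<ge> 0\<close>, and \<open>\<epsilon>\<close> has to be bounded from below.

  By Fueredi's stability argument the link of \<open>v\<close> has a partition into \<open>t\<close> classes which are
  blue cliques up to an \<open>\<epsilon>\<close>-fraction of all pairs. Count the pairs \<open>w, x\<close> in a common class of
  \<open>v\<close> that are blue in the link of a second vertex \<open>z\<close>. In a class avoiding \<open>z\<close>, Turan's theorem for
  the link of \<open>z\<close> makes a \<open>1/t\<close>-fraction of the pairs blue. In the class of \<open>z\<close>, both \<open>w\<close> and
  \<open>x\<close> are typically blue neighbours of \<open>z\<close> in the link of \<open>v\<close>, so by symmetry blue neighbours of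
  \<open>v\<close> in the link of \<open>z\<close>, and nearly all such pairs are blue there. The total density is thus at
  least about \<open>1/t\<^sup>2 + (t - 1)/t\<^sup>3\<close>. It is also at most the mean squared blue codegree plus
  \<open>O(\<epsilon>)\<close>, and Turan's theorem in red neighbourhoods bounds that mean square by
  \<open>1/t\<^sup>2 + O(\<epsilon>)\<close>. Hence \<open>\<epsilon>\<close> is of order at least \<open>1/t\<^sup>2\<close>.
\<close>

section \<open>Stability for clique-free graphs\<close>

definition clique_free :: "('a \<Rightarrow> 'a \<Rightarrow> bool) \<Rightarrow> nat \<Rightarrow> 'a set \<Rightarrow> bool" where
  "clique_free E k A \<longleftrightarrow>
     (\<nexists>K. K \<subseteq> A \<and> finite K \<and> card K = k \<and> (\<forall>x\<in>K. \<forall>y\<in>K. x \<noteq> y \<longrightarrow> E x y))"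

lemma clique_freeD:
  assumes "clique_free E k A" and "K \<subseteq> A" "finite K" "card K = k"
    and "\<And>x y. x \<in> K \<Longrightarrow> y \<in> K \<Longrightarrow> x \<noteq> y \<Longrightarrow> E x y"
  shows False
  using assms unfolding clique_free_def by metis

lemma clique_free_mono:
  assumes "clique_free E k A" and "B \<subseteq> A"
  shows "clique_free E k B"
  using clique_freeD[OF assms(1)] assms(2) unfolding clique_free_def by (metis subset_trans)

lemma clique_free_neighbourhood:
  assumes "clique_free E (Suc k) A" and "x \<in> A"
    and sym: "\<And>a b. E a b \<Longrightarrow> E b a" and irr: "\<And>a. \<not> E a a"
  shows "clique_free E k {y\<in>A. E x y}"
  unfolding clique_free_def
proof
  assume "\<exists>K. K \<subseteq> {y\<in>A. E x y} \<and> finite K \<and> card K = k \<and> (\<forall>x\<in>K. \<forall>y\<in>K. x \<noteq> y \<longrightarrow> E x y)"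
  then obtain K where K: "K \<subseteq> {y\<in>A. E x y}" "finite K" "card K = k"
    "\<forall>x\<in>K. \<forall>y\<in>K. x \<noteq> y \<longrightarrow> E x y" by blast
  have "x \<notin> K" using K(1) irr by blast
  then have "card (insert x K) = Suc k" using K by simp
  moreover have "E a b" if "a \<in> insert x K" "b \<in> insert x K" "a \<noteq> b" for a b
    using K(1,4) that by (auto intro: sym)
  moreover have "insert x K \<subseteq> A" using K(1) assms(2) by blast
  ultimately show False using clique_freeD[OF assms(1)] K(2) by (meson finite_insert)
qed

lemma sum_Un_square:
  fixes f :: "'a \<Rightarrow> 'a \<Rightarrow> real"
  assumes "finite A" "finite B" "A \<inter> B = {}"
  shows "(\<Sum>x\<in>A \<union> B. \<Sum>y\<in>A \<union> B. f x y) =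
    (\<Sum>x\<in>A. \<Sum>y\<in>A. f x y) + (\<Sum>x\<in>A. \<Sum>y\<in>B. f x y) + (\<Sum>x\<in>B. \<Sum>y\<in>A. f x y) + (\<Sum>x\<in>B. \<Sum>y\<in>B. f x y)"
  unfolding sum.union_disjoint[OF assms] sum.distrib by simp

text \<open>Fueredi's argument: peel off the non-neighbours of a vertex of maximum degree.\<close>

lemma clique_free_partition:
  fixes E :: "'a \<Rightarrow> 'a \<Rightarrow> bool"
  assumes "finite A" and "clique_free E (Suc t) A"
    and sym: "\<And>a b. E a b \<Longrightarrow> E b a" and irr: "\<And>a. \<not> E a a"
  shows "\<exists>p. (\<forall>x\<in>A. p x < t) \<and>
    (\<Sum>x\<in>A. \<Sum>y\<in>A. of_bool (E x y)) + (\<Sum>x\<in>A. \<Sum>y\<in>A. of_bool (p x = p y \<and> E x y))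
      \<le> (\<Sum>x\<in>A. \<Sum>y\<in>A. of_bool (p x \<noteq> p y) :: real)"
  using assms(1,2)
proof (induction t arbitrary: A)
  case 0
  have "A = {}"
  proof (rule ccontr)
    assume "A \<noteq> {}"
    then obtain x where "x \<in> A" by blast
    then show False using clique_freeD[OF 0(2), of "{x}"] by simp
  qed
  then show ?case by simp
next
  case (Suc t)
  show ?case
  proof (cases "A = {}")
    case True
    then show ?thesis by simp
  next
    case False
    define dg where "dg x = (\<Sum>y\<in>A. of_bool (E x y) :: real)" for x
    have "\<exists>x\<in>A. \<forall>y\<in>A. dg y \<le> dg x"
    proof -
      have "Max (dg ` A) \<in> dg ` A" using Suc.prems(1) False by simp
      then obtain x where "x \<in> A" "dg x = Max (dg ` A)" by force
      then show ?thesis using Suc.prems(1) by (metis Max_ge finite_imageI imageI)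
    qed
    then obtain x where x: "x \<in> A" "\<And>y. y \<in> A \<Longrightarrow> dg y \<le> dg x" by blast
    define N where "N = {y\<in>A. E x y}"
    define M where "M = {y\<in>A. \<not> E x y}"
    have A: "A = M \<union> N" "M \<inter> N = {}" "finite M" "finite N"
      using Suc.prems(1) by (auto simp: M_def N_def)
    have "clique_free E (Suc t) N"
      unfolding N_def by (rule clique_free_neighbourhood[OF Suc.prems(2) x(1) sym irr])
    from Suc.IH[OF A(4) this] obtain p where p: "\<forall>x\<in>N. p x < t"
      "(\<Sum>x\<in>N. \<Sum>y\<in>N. of_bool (E x y)) + (\<Sum>x\<in>N. \<Sum>y\<in>N. of_bool (p x = p y \<and> E x y))
        \<le> (\<Sum>x\<in>N. \<Sum>y\<in>N. of_bool (p x \<noteq> p y) :: real)" by blast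
    define q where "q y = (if y \<in> N then p y else t)" for y
    have qN: "q y = p y" if "y \<in> N" for y using that by (simp add: q_def)
    have qM: "q y = t" if "y \<in> M" for y using that A(2) by (auto simp: q_def)
    have qMN: "q y \<noteq> q z" if "y \<in> M" "z \<in> N" for y z using qM[OF that(1)] qN[OF that(2)] p(1) that(2) by auto
    have dgx: "dg x = real (card N)"
      unfolding dg_def N_def using Suc.prems(1) by (simp add: sum.If_cases of_bool_def Int_def)
    have dgU: "dg y = (\<Sum>z\<in>M. of_bool (E y z)) + (\<Sum>z\<in>N. of_bool (E y z))" for y
      unfolding dg_def A(1) by (rule sum.union_disjoint[OF A(3,4,2)])
    \<comment> \<open>Every degree in \<open>M\<close> is at most \<open>card N\<close>, the degree
      of \<open>x\<close>. Adding the class \<open>M\<close> raises the left side of the claim by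
      twice the edges inside \<open>M\<close> and twice those between \<open>M\<close> and
      \<open>N\<close>, hence by at most twice \<open>card M * card N\<close>, which is exactly the
      gain on the right.\<close>
    have "(\<Sum>y\<in>M. dg y) \<le> (\<Sum>y\<in>M. real (card N))"
      unfolding dgx[symmetric]
      by (rule sum_mono) (simp add: x(2) M_def)
    then have deg: "(\<Sum>y\<in>M. \<Sum>z\<in>M. of_bool (E y z)) + (\<Sum>y\<in>M. \<Sum>z\<in>N. of_bool (E y z))
        \<le> real (card M) * real (card N)"
      unfolding dgU sum.distrib by simp
    have E_commute: "E y z = E z y" for y z using sym by blast
    have swap: "(\<Sum>y\<in>N. \<Sum>z\<in>M. of_bool (E y z)) = (\<Sum>y\<in>M. \<Sum>z\<in>N. of_bool (E y z) :: real)"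
      by (subst sum.swap) (simp only: E_commute)
    have MM: "(\<Sum>y\<in>M. \<Sum>z\<in>M. of_bool (q y = q z \<and> E y z)) = (\<Sum>y\<in>M. \<Sum>z\<in>M. of_bool (E y z) :: real)"
      by (intro sum.cong refl) (simp add: qM)
    have MN: "(\<Sum>y\<in>M. \<Sum>z\<in>N. of_bool (q y = q z \<and> E y z)) = (0::real)"
      by (intro sum.neutral ballI) (simp add: qMN)
    have NM: "(\<Sum>y\<in>N. \<Sum>z\<in>M. of_bool (q y = q z \<and> E y z)) = (0::real)"
      by (intro sum.neutral ballI) (simp add: not_sym[OF qMN])
    have NN: "(\<Sum>y\<in>N. \<Sum>z\<in>N. of_bool (q y = q z \<and> E y z))
        = (\<Sum>y\<in>N. \<Sum>z\<in>N. of_bool (p y = p z \<and> E y z) :: real)"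
      by (intro sum.cong refl) (simp add: qN)
    have MM': "(\<Sum>y\<in>M. \<Sum>z\<in>M. of_bool (q y \<noteq> q z)) = (0::real)"
      by (intro sum.neutral ballI) (simp add: qM)
    have MN': "(\<Sum>y\<in>M. \<Sum>z\<in>N. of_bool (q y \<noteq> q z)) = real (card M) * real (card N)"
      by (simp add: qMN)
    have NM': "(\<Sum>y\<in>N. \<Sum>z\<in>M. of_bool (q y \<noteq> q z)) = real (card M) * real (card N)"
      by (simp add: not_sym[OF qMN])
    have NN': "(\<Sum>y\<in>N. \<Sum>z\<in>N. of_bool (q y \<noteq> q z))
        = (\<Sum>y\<in>N. \<Sum>z\<in>N. of_bool (p y \<noteq> p z) :: real)"
      by (intro sum.cong refl) (simp add: qN)
    have "(\<Sum>x\<in>A. \<Sum>y\<in>A. of_bool (E x y)) + (\<Sum>x\<in>A. \<Sum>y\<in>A. of_bool (q x = q y \<and> E x y))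
        \<le> (\<Sum>x\<in>A. \<Sum>y\<in>A. of_bool (q x \<noteq> q y) :: real)"
      unfolding A(1) sum_Un_square[OF A(3,4,2)]
      using deg p(2) unfolding swap MM MN NM NN MM' MN' NM' NN' by linarith
    moreover have "\<forall>y\<in>A. q y < Suc t"
      using p(1) by (simp add: q_def less_Suc_eq)
    ultimately show ?thesis by blast
  qed
qed

section \<open>Convexity over colour classes and Turan's theorem\<close>

lemma sum_by_colour:
  fixes f :: "'a \<Rightarrow> 'a \<Rightarrow> real"
  assumes "finite A" and "\<forall>x\<in>A. p x < (t::nat)"
  shows "(\<Sum>x\<in>A. \<Sum>y\<in>A. of_bool (p x = p y) * f x y) =
    (\<Sum>i<t. \<Sum>x\<in>{x\<in>A. p x = i}. \<Sum>y\<in>{x\<in>A. p x = i}. f x y)"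
proof -
  have "(\<Sum>x\<in>A. \<Sum>y\<in>A. of_bool (p x = p y) * f x y)
      = (\<Sum>i<t. \<Sum>x\<in>{x\<in>A. p x = i}. \<Sum>y\<in>A. of_bool (p x = p y) * f x y)"
    by (rule sum.group[symmetric]) (use assms in auto)
  also have "\<dots> = (\<Sum>i<t. \<Sum>x\<in>{x\<in>A. p x = i}. \<Sum>y\<in>{x\<in>A. p x = i}. f x y)"
  proof (rule sum.cong[OF refl], rule sum.cong[OF refl])
    fix i x assume "x \<in> {x\<in>A. p x = i}"
    then show "(\<Sum>y\<in>A. of_bool (p x = p y) * f x y) = (\<Sum>y\<in>{x\<in>A. p x = i}. f x y)"
      unfolding sum.inter_filter[OF assms(1)] by (intro sum.cong refl) auto
  qed
  finally show ?thesis .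
qed

lemma sum_card_colour_classes:
  assumes "finite A" and "\<forall>x\<in>A. p x < (t::nat)"
  shows "(\<Sum>i<t. real (card {x\<in>A. p x = i})) = real (card A)"
proof -
  have "(\<Sum>i<t. \<Sum>x\<in>{x\<in>A. p x = i}. 1) = (\<Sum>x\<in>A. 1 :: real)"
    by (rule sum.group) (use assms in auto)
  then show ?thesis by simp
qed

lemma power_mean_2:
  fixes X :: "nat \<Rightarrow> real"
  assumes "t > 0"
  shows "(\<Sum>i<t. X i)\<^sup>2 / t \<le> (\<Sum>i<t. (X i)\<^sup>2)"
proof -
  define m where "m = (\<Sum>i<t. X i) / t"
  have s: "(\<Sum>i<t. X i) = t * m" using assms by (simp add: m_def)
  have "(\<Sum>i<t. 2 * m * X i - m\<^sup>2) \<le> (\<Sum>i<t. (X i)\<^sup>2)"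
  proof (rule sum_mono)
    fix i show "2 * m * X i - m\<^sup>2 \<le> (X i)\<^sup>2"
      using zero_le_power2[of "X i - m"] by (simp add: power2_diff algebra_simps)
  qed
  then have "2 * m * (t * m) - t * m\<^sup>2 \<le> (\<Sum>i<t. (X i)\<^sup>2)"
    by (simp add: sum_subtractf sum_distrib_left[symmetric] s)
  moreover have "(t * m)\<^sup>2 / t = 2 * m * (t * m) - t * m\<^sup>2"
    using assms by (simp add: power2_eq_square)
  ultimately show ?thesis unfolding s by linarith
qed

lemma power_mean_3:
  fixes X :: "nat \<Rightarrow> real"
  assumes "t > 0" and nonneg: "\<And>i. X i \<ge> 0"
  shows "(\<Sum>i<t. X i) ^ 3 / t\<^sup>2 \<le> (\<Sum>i<t. X i ^ 3)"
proof -
  define m where "m = (\<Sum>i<t. X i) / t"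
  have m0: "m \<ge> 0" unfolding m_def by (intro divide_nonneg_nonneg sum_nonneg nonneg) simp
  have s: "(\<Sum>i<t. X i) = t * m" using assms(1) by (simp add: m_def)
  have "(\<Sum>i<t. 3 * m\<^sup>2 * X i - 2 * m ^ 3) \<le> (\<Sum>i<t. X i ^ 3)"
  proof (rule sum_mono)
    fix i
    \<comment> \<open>This product is the gap between the cube and its tangent at the mean
      \<open>m\<close>; summed over \<open>i\<close>, the tangents give the claim.\<close>
    have "0 \<le> (X i - m)\<^sup>2 * (X i + 2 * m)" using nonneg[of i] m0 by simp
    then show "3 * m\<^sup>2 * X i - 2 * m ^ 3 \<le> X i ^ 3"
      by (simp add: power2_eq_square power3_eq_cube algebra_simps)
  qed
  then have "3 * m\<^sup>2 * (t * m) - t * (2 * m ^ 3) \<le> (\<Sum>i<t. X i ^ 3)"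
    by (simp add: sum_subtractf sum_distrib_left[symmetric] s)
  moreover have "(t * m) ^ 3 / t\<^sup>2 = 3 * m\<^sup>2 * (t * m) - t * (2 * m ^ 3)"
    using assms(1) by (simp add: power2_eq_square power3_eq_cube)
  ultimately show ?thesis unfolding s by linarith
qed

lemma monochromatic_pairs_ge:
  assumes "finite A" and "\<forall>x\<in>A. p x < (t::nat)" and "t > 0"
  shows "(real (card A))\<^sup>2 / t \<le> (\<Sum>x\<in>A. \<Sum>y\<in>A. of_bool (p x = p y) :: real)"
proof -
  have "(real (card A))\<^sup>2 / t \<le> (\<Sum>i<t. (real (card {x\<in>A. p x = i}))\<^sup>2)"
    using power_mean_2[OF assms(3), of "\<lambda>i. real (card {x\<in>A. p x = i})"]
    unfolding sum_card_colour_classes[OF assms(1,2)] .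
  also have "\<dots> = (\<Sum>x\<in>A. \<Sum>y\<in>A. of_bool (p x = p y) * 1)"
    unfolding sum_by_colour[OF assms(1,2)] by (simp add: power2_eq_square)
  finally show ?thesis by simp
qed

text \<open>Turan's theorem: drop the edges inside classes from the stability inequality. Ordered
  pairs are counted with the diagonal, so no lower-order term appears.\<close>

lemma turan_nonadjacent_pairs:
  fixes E :: "'a \<Rightarrow> 'a \<Rightarrow> bool"
  assumes "finite A" and "clique_free E (Suc t) A" and "t > 0"
    and sym: "\<And>a b. E a b \<Longrightarrow> E b a" and irr: "\<And>a. \<not> E a a"
  shows "(real (card A))\<^sup>2 / t \<le> (\<Sum>x\<in>A. \<Sum>y\<in>A. of_bool (\<not> E x y) :: real)"
proof -
  obtain p where p: "\<forall>x\<in>A. p x < t"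
    "(\<Sum>x\<in>A. \<Sum>y\<in>A. of_bool (E x y)) + (\<Sum>x\<in>A. \<Sum>y\<in>A. of_bool (p x = p y \<and> E x y))
      \<le> (\<Sum>x\<in>A. \<Sum>y\<in>A. of_bool (p x \<noteq> p y) :: real)"
    using clique_free_partition[OF assms(1,2) sym irr] by blast
  have "0 \<le> (\<Sum>x\<in>A. \<Sum>y\<in>A. of_bool (p x = p y \<and> E x y) :: real)"
    by (intro sum_nonneg) simp
  moreover note monochromatic_pairs_ge[OF assms(1) p(1) assms(3)]
  moreover note p(2)
  ultimately show ?thesis
    by (simp add: of_bool_not_iff sum_subtractf)
qed

section \<open>Triple systems with clique-free links\<close>

text \<open>The two swaps generate all permutations of a triple, so \<open>red_irrefl\<close>
  excludes red triples with any repetition.\<close>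

locale triple_system =
  fixes V :: "'a set" and red :: "'a \<Rightarrow> 'a \<Rightarrow> 'a \<Rightarrow> bool" and t :: nat
  assumes finite_V: "finite V"
    and red_swap12: "red a b c \<Longrightarrow> red b a c"
    and red_swap23: "red a b c \<Longrightarrow> red a c b"
    and red_irrefl: "\<not> red a b b"
    and t_ge_2: "t \<ge> 2"
    and link_clique_free: "v \<in> V \<Longrightarrow> clique_free (red v) (Suc t) V"
begin

text \<open>Triples with a repeated vertex are blue, so every sum below runs over all of \<open>V\<close>.\<close>

definition blue :: "'a \<Rightarrow> 'a \<Rightarrow> 'a \<Rightarrow> real" where
  "blue a b c = of_bool (\<not> red a b c)"

definition N :: real where "N = real (card V)"

definition codeg :: "'a \<Rightarrow> 'a \<Rightarrow> real" where
  "codeg v w = (\<Sum>x\<in>V. blue v w x)"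

definition blue_triples :: real where
  "blue_triples = (\<Sum>v\<in>V. \<Sum>w\<in>V. codeg v w)"

definition codeg_squares :: real where
  "codeg_squares = (\<Sum>v\<in>V. \<Sum>w\<in>V. (codeg v w)\<^sup>2)"

text \<open>Blue paths \<open>w\<close>, \<open>x\<close>, \<open>y\<close> in the link of
  \<open>v\<close> whose ends are joined in red. There are none exactly when blue adjacency in every
  link is transitive, that is, when each blue link is a disjoint union of cliques.\<close>

definition open_cherries :: real where
  "open_cherries = (\<Sum>v\<in>V. \<Sum>x\<in>V. \<Sum>w\<in>V. \<Sum>y\<in>V. blue v x w * blue v x y * (1 - blue v w y))"

lemma blue_swap12: "blue a b c = blue b a c"
  unfolding blue_def using red_swap12[of a b c] red_swap12[of b a c] by auto

lemma blue_swap23: "blue a b c = blue a c b"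
  unfolding blue_def using red_swap23[of a b c] red_swap23[of a c b] by auto

lemma blue_ge_0: "0 \<le> blue a b c" and blue_le_1: "blue a b c \<le> 1"
  by (simp_all add: blue_def)

lemma codeg_swap: "(\<Sum>x\<in>V. blue v x w) = codeg v w"
  unfolding codeg_def by (intro sum.cong refl) (rule blue_swap23)

section \<open>Turan bounds in links and in red neighbourhoods\<close>

lemma clique_free_link_ge:
  assumes "v \<in> V" and "A \<subseteq> V"
  shows "(real (card A))\<^sup>2 / t \<le> (\<Sum>x\<in>A. \<Sum>y\<in>A. blue v x y)"
  unfolding blue_def
  by (rule turan_nonadjacent_pairs[OF finite_subset[OF assms(2) finite_V]
        clique_free_mono[OF link_clique_free[OF assms(1)] assms(2)]])
    (use t_ge_2 red_swap23 red_irrefl in auto)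

text \<open>In the link of \<open>v\<close>, the \<open>N - codeg v x\<close> red neighbours of
  \<open>x\<close> span no clique on \<open>t\<close> vertices, so Turan's theorem applies with
  \<open>t - 1\<close> classes.\<close>

lemma red_neighbourhood_ge:
  assumes "v \<in> V" and "x \<in> V"
  shows "(N - codeg v x)\<^sup>2 / (real t - 1)
    \<le> (\<Sum>w\<in>V. \<Sum>y\<in>V. (1 - blue v x w) * (1 - blue v x y) * blue v w y)"
proof -
  define A where "A = {w\<in>V. red v x w}"
  have filt: "(\<Sum>w\<in>A. f w) = (\<Sum>w\<in>V. (1 - blue v x w) * f w)" for f :: "'a \<Rightarrow> real"
    unfolding A_def sum.inter_filter[OF finite_V] by (intro sum.cong refl) (simp add: blue_def)
  have "real (card A) = (\<Sum>w\<in>A. 1)" by simp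
  also have "\<dots> = N - codeg v x"
    unfolding filt N_def codeg_def by (simp add: sum_subtractf)
  finally have card: "real (card A) = N - codeg v x" .
  have "clique_free (red v) (Suc (t - 1)) A"
    using clique_free_neighbourhood[OF link_clique_free[OF assms(1)] assms(2)]
      red_swap23 red_irrefl t_ge_2 unfolding A_def by simp
  then have "(real (card A))\<^sup>2 / real (t - 1) \<le> (\<Sum>w\<in>A. \<Sum>y\<in>A. of_bool (\<not> red v w y))"
    by (intro turan_nonadjacent_pairs)
      (use finite_V t_ge_2 red_swap23 red_irrefl in \<open>auto simp: A_def\<close>)
  then show ?thesis
    using t_ge_2 unfolding card blue_def[symmetric] filt
    by (simp add: sum_distrib_left of_nat_diff mult.assoc)
qed

text \<open>Blue paths of length two in a link are counted by the squared codegree of their centre;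
  this and the next two lemmas put the centre at \<open>x\<close>, \<open>w\<close> and
  \<open>y\<close>.\<close>

lemma cherry_sum_centre_first:
  "(\<Sum>x\<in>V. \<Sum>w\<in>V. \<Sum>y\<in>V. blue v x w * blue v x y) = (\<Sum>x\<in>V. (codeg v x)\<^sup>2)"
  by (intro sum.cong refl) (simp add: codeg_def power2_eq_square sum_product)

lemma cherry_sum_centre_second:
  "(\<Sum>x\<in>V. \<Sum>w\<in>V. \<Sum>y\<in>V. blue v x w * blue v w y) = (\<Sum>x\<in>V. (codeg v x)\<^sup>2)"
  by (subst sum.swap)
    (simp add: sum_distrib_left[symmetric] sum_distrib_right[symmetric] codeg_swap
      codeg_def[symmetric] power2_eq_square)

lemma cherry_sum_centre_third:
  "(\<Sum>x\<in>V. \<Sum>w\<in>V. \<Sum>y\<in>V. blue v x y * blue v w y) = (\<Sum>x\<in>V. (codeg v x)\<^sup>2)"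
proof -
  have "(\<Sum>x\<in>V. \<Sum>w\<in>V. \<Sum>y\<in>V. blue v x y * blue v w y)
      = (\<Sum>x\<in>V. \<Sum>y\<in>V. \<Sum>w\<in>V. blue v x y * blue v y w)"
    by (subst (2) sum.swap) (intro sum.cong refl, metis blue_swap23)
  then show ?thesis unfolding cherry_sum_centre_second .
qed

text \<open>Obtained by summing \<open>red_neighbourhood_ge\<close> over \<open>v\<close> and
  \<open>x\<close>. It bounds open cherries and codegree squares together, in terms of the blue
  density.\<close>

lemma open_cherries_turan:
  "(real t - 1) * open_cherries + t * codeg_squares \<le> (real t + 1) * N * blue_triples - N ^ 4"
proof -
  let ?S = "\<Sum>v\<in>V. \<Sum>x\<in>V. \<Sum>w\<in>V. \<Sum>y\<in>V. (1 - blue v x w) * (1 - blue v x y) * blue v w y"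
  \<comment> \<open>Adding the open cherries cancels the cubic term \<open>p * q * r\<close>, the
    blue triangles of the links. What remains is a single blue pair and three cherry sums, all
    computable.\<close>
  have id: "(1 - p) * (1 - q) * r + p * q * (1 - r) = r - p * r - q * r + p * q" for p q r :: real
    by (simp add: algebra_simps)
  have "?S + open_cherries = (\<Sum>v\<in>V. \<Sum>x\<in>V. \<Sum>w\<in>V. \<Sum>y\<in>V.
      blue v w y - blue v x w * blue v w y - blue v x y * blue v w y + blue v x w * blue v x y)"
    unfolding open_cherries_def sum.distrib[symmetric] id ..
  also have "\<dots> = N * blue_triples - codeg_squares"
    unfolding sum.distrib sum_subtractf cherry_sum_centre_first cherry_sum_centre_second
      cherry_sum_centre_third
    by (simp add: N_def blue_triples_def codeg_squares_def codeg_def sum_distrib_left[symmetric])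
  finally have S: "?S = N * blue_triples - codeg_squares - open_cherries" by simp
  have "(\<Sum>v\<in>V. \<Sum>x\<in>V. (N - codeg v x)\<^sup>2 / (real t - 1)) \<le> ?S"
    by (intro sum_mono red_neighbourhood_ge)
  moreover have "(\<Sum>v\<in>V. \<Sum>x\<in>V. (N - codeg v x)\<^sup>2 / (real t - 1))
      = (N ^ 4 - 2 * N * blue_triples + codeg_squares) / (real t - 1)"
    unfolding blue_triples_def codeg_squares_def power2_diff sum_divide_distrib[symmetric]
      sum.distrib sum_subtractf sum_distrib_left[symmetric]
    by (simp add: N_def[symmetric] power4_eq_xxxx power2_eq_square mult.assoc)
  ultimately have "(N ^ 4 - 2 * N * blue_triples + codeg_squares) / (real t - 1)
      \<le> N * blue_triples - codeg_squares - open_cherries" using S by simp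
  then have "N ^ 4 - 2 * N * blue_triples + codeg_squares
      \<le> (N * blue_triples - codeg_squares - open_cherries) * (real t - 1)"
    using t_ge_2 by (simp add: pos_divide_le_eq)
  then show ?thesis by (simp add: algebra_simps)
qed

text \<open>Cauchy-Schwarz with a free parameter \<open>c\<close>, which later becomes the mean
  codegree.\<close>

lemma codeg_squares_ge: "2 * c * blue_triples - c\<^sup>2 * N\<^sup>2 \<le> codeg_squares"
proof -
  have "0 \<le> (\<Sum>v\<in>V. \<Sum>w\<in>V. (codeg v w - c)\<^sup>2)" by (intro sum_nonneg) simp
  also have "\<dots> = codeg_squares - 2 * c * blue_triples + c\<^sup>2 * N\<^sup>2"
    unfolding blue_triples_def codeg_squares_def N_def power2_diff sum.distrib sum_subtractf
    by (simp add: sum_distrib_left power2_eq_square mult_ac)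
  finally show ?thesis by simp
qed

section \<open>Pairs in a common class of one link, counted in a second link\<close>

text \<open>
  The right-hand side is evaluated class by class. Classes containing \<open>z\<close> lose only the red pairs of
  the link of \<open>v\<close> inside a class and the open cherries with centre \<open>v\<close> in the link of \<open>z\<close>.
\<close>

lemma colour_class_ge:
  fixes p :: "'a \<Rightarrow> nat" and v :: 'a
  assumes p: "\<forall>x\<in>V. p x < t"
  defines "a \<equiv> (\<Sum>w\<in>V. \<Sum>x\<in>V. of_bool (p w = p x) * (1 - blue v w x))"
  shows "(2 - 1 / t) * N ^ 3 / (real t)\<^sup>2 - 2 * N * a
      - (\<Sum>z\<in>V. \<Sum>w\<in>V. \<Sum>x\<in>V. blue v z w * blue v z x * (1 - blue z w x))
    \<le> (\<Sum>z\<in>V. \<Sum>w\<in>V. \<Sum>x\<in>V. of_bool (p w = p x) * blue z w x)"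
proof -
  define P where "P i = {x\<in>V. p x = i}" for i
  define X where "X i = real (card (P i))" for i
  define R where "R i = (\<Sum>z\<in>P i. \<Sum>w\<in>P i. 1 - blue v z w)" for i
  define c where "c z w x = blue v z w * blue v z x * (1 - blue z w x)" for z w x
  define C where "C i = (\<Sum>z\<in>P i. \<Sum>w\<in>P i. \<Sum>x\<in>P i. c z w x)" for i
  have PV: "P i \<subseteq> V" "finite (P i)" for i using finite_V by (auto simp: P_def)
  have X0: "0 \<le> X i" and XN: "X i \<le> N" for i
    using PV finite_V by (auto simp: X_def N_def card_mono)
  have sumX: "(\<Sum>i<t. X i) = N"
    unfolding X_def P_def N_def by (rule sum_card_colour_classes[OF finite_V p])
  have R0: "0 \<le> R i" for i
    unfolding R_def by (intro sum_nonneg) (simp add: blue_le_1)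
  have sumR: "(\<Sum>i<t. R i) = a"
    unfolding a_def sum_by_colour[OF finite_V p] R_def P_def ..
  have c0: "0 \<le> c z w x" for z w x
    unfolding c_def by (simp add: blue_ge_0 blue_le_1)
  have inside: "X i ^ 3 - 2 * X i * R i - C i \<le> (\<Sum>z\<in>P i. \<Sum>w\<in>P i. \<Sum>x\<in>P i. blue z w x)" for i
  proof -
    have "X i ^ 3 - 2 * X i * R i - C i
      = (\<Sum>z\<in>P i. \<Sum>w\<in>P i. \<Sum>x\<in>P i. 1 - (1 - blue v z w) - (1 - blue v z x) - c z w x)"
      unfolding C_def R_def X_def
      by (simp add: sum_subtractf sum.distrib sum_distrib_left[symmetric] power3_eq_cube algebra_simps)
    \<comment> \<open>Termwise: if \<open>z\<close> is joined in blue to both \<open>w\<close> and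
      \<open>x\<close> in the link of \<open>v\<close>, then \<open>c z w x\<close> is
      \<open>1 - blue z w x\<close> and equality holds; otherwise the left term is at most
      0.\<close>
    also have "\<dots> \<le> (\<Sum>z\<in>P i. \<Sum>w\<in>P i. \<Sum>x\<in>P i. blue z w x)"
      by (intro sum_mono) (simp add: c_def blue_def)
    finally show ?thesis .
  qed
  have outside: "(N - X i) * ((X i)\<^sup>2 / t) \<le> (\<Sum>z\<in>V - P i. \<Sum>w\<in>P i. \<Sum>x\<in>P i. blue z w x)" for i
  proof -
    have "(\<Sum>z\<in>V - P i. (X i)\<^sup>2 / t) \<le> (\<Sum>z\<in>V - P i. \<Sum>w\<in>P i. \<Sum>x\<in>P i. blue z w x)"
      unfolding X_def by (intro sum_mono clique_free_link_ge PV) simp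
    moreover have "real (card (V - P i)) = N - X i"
      unfolding N_def X_def using PV[of i] finite_V
      by (simp add: card_Diff_subset of_nat_diff card_mono)
    ultimately show ?thesis by simp
  qed
  have "(\<Sum>i<t. C i) \<le> (\<Sum>i<t. \<Sum>z\<in>P i. \<Sum>w\<in>V. \<Sum>x\<in>V. c z w x)"
    unfolding C_def
    by (intro sum_mono order_trans[OF sum_mono[OF sum_mono2] sum_mono2] finite_V PV sum_nonneg c0)
  also have "\<dots> = (\<Sum>z\<in>V. \<Sum>w\<in>V. \<Sum>x\<in>V. c z w x)"
    unfolding P_def by (rule sum.group) (use finite_V p in auto)
  finally have sumC: "(\<Sum>i<t. C i) \<le> (\<Sum>z\<in>V. \<Sum>w\<in>V. \<Sum>x\<in>V. c z w x)" .
  have "(\<Sum>i<t. X i * R i) \<le> (\<Sum>i<t. N * R i)"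
    by (intro sum_mono mult_right_mono XN R0)
  then have sumXR: "(\<Sum>i<t. X i * R i) \<le> N * a"
    unfolding sum_distrib_left[symmetric] sumR .
  have t0: "t > 0" using t_ge_2 by simp
  note pm = power_mean_2[OF t0, of X, unfolded sumX] power_mean_3[of t X, OF t0 X0, unfolded sumX]
  \<comment> \<open>Collecting powers of \<open>X i\<close> in
    \<open>X i ^ 3 + (N - X i) * X i ^ 2 / t\<close> gives nonnegative coefficients
    \<open>1 - 1 / t\<close> and \<open>N / t\<close>, so both power means apply; the bound is
    attained by equal classes.\<close>
  have "(2 - 1 / t) * N ^ 3 / (real t)\<^sup>2 = (1 - 1 / t) * (N ^ 3 / (real t)\<^sup>2) + N / t * (N\<^sup>2 / t)"
    by (simp add: power2_eq_square power3_eq_cube algebra_simps diff_divide_distrib)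
  also have "\<dots> \<le> (1 - 1 / t) * (\<Sum>i<t. X i ^ 3) + N / t * (\<Sum>i<t. (X i)\<^sup>2)"
    using pm t_ge_2 by (intro add_mono mult_left_mono) (auto simp: N_def)
  also have "\<dots> = (\<Sum>i<t. X i ^ 3 + (N - X i) * ((X i)\<^sup>2 / t))"
    unfolding sum_distrib_left sum.distrib[symmetric]
    by (intro sum.cong refl)
      (simp add: power2_eq_square power3_eq_cube algebra_simps diff_divide_distrib)
  finally have "(2 - 1 / t) * N ^ 3 / (real t)\<^sup>2 - 2 * N * a - (\<Sum>z\<in>V. \<Sum>w\<in>V. \<Sum>x\<in>V. c z w x)
      \<le> (\<Sum>i<t. X i ^ 3 + (N - X i) * ((X i)\<^sup>2 / t)) - 2 * (\<Sum>i<t. X i * R i) - (\<Sum>i<t. C i)"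
    using sumXR sumC by linarith
  also have "\<dots> = (\<Sum>i<t. (X i ^ 3 - 2 * X i * R i - C i) + (N - X i) * ((X i)\<^sup>2 / t))"
    unfolding sum_distrib_left sum_subtractf[symmetric]
    by (intro sum.cong refl) simp
  also have "\<dots> \<le> (\<Sum>i<t. (\<Sum>z\<in>P i. \<Sum>w\<in>P i. \<Sum>x\<in>P i. blue z w x)
      + (\<Sum>z\<in>V - P i. \<Sum>w\<in>P i. \<Sum>x\<in>P i. blue z w x))"
    by (intro sum_mono add_mono inside outside)
  also have "\<dots> = (\<Sum>i<t. \<Sum>z\<in>V. \<Sum>w\<in>P i. \<Sum>x\<in>P i. blue z w x)"
    by (rule sum.cong[OF refl], subst add.commute, rule sum.subset_diff[OF PV(1) finite_V, symmetric])
  also have "\<dots> = (\<Sum>z\<in>V. \<Sum>w\<in>V. \<Sum>x\<in>V. of_bool (p w = p x) * blue z w x)"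
    unfolding sum_by_colour[OF finite_V p] P_def by (rule sum.swap)
  finally show ?thesis unfolding c_def .
qed

text \<open>A pair in a common class is either blue in the link of \<open>v\<close>, hence blue in
  both links when counted, or is a red pair inside a class. The latter does not depend on
  \<open>z\<close>, whence the factor \<open>N\<close>.\<close>

lemma colour_class_le:
  fixes p :: "'a \<Rightarrow> nat"
  shows "(\<Sum>z\<in>V. \<Sum>w\<in>V. \<Sum>x\<in>V. of_bool (p w = p x) * blue z w x)
    \<le> (\<Sum>z\<in>V. \<Sum>w\<in>V. \<Sum>x\<in>V. blue v w x * blue z w x)
      + N * (\<Sum>w\<in>V. \<Sum>x\<in>V. of_bool (p w = p x) * (1 - blue v w x))"
proof -
  have "(\<Sum>z\<in>V. \<Sum>w\<in>V. \<Sum>x\<in>V. of_bool (p w = p x) * blue z w x)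
    \<le> (\<Sum>z\<in>V. \<Sum>w\<in>V. \<Sum>x\<in>V. blue v w x * blue z w x + of_bool (p w = p x) * (1 - blue v w x))"
    by (intro sum_mono) (auto simp: blue_def)
  then show ?thesis by (simp add: sum.distrib N_def)
qed

lemma link_ge:
  assumes v: "v \<in> V"
  shows "(2 - 1 / t) * N ^ 3 / (real t)\<^sup>2 + 3 * N * (N\<^sup>2 / t)
    \<le> (\<Sum>z\<in>V. \<Sum>w\<in>V. \<Sum>x\<in>V. blue v w x * blue z w x)
      + (\<Sum>z\<in>V. \<Sum>w\<in>V. \<Sum>x\<in>V. blue v z w * blue v z x * (1 - blue z w x))
      + 3 * N * (\<Sum>w\<in>V. codeg v w)"
proof -
  obtain p where p: "\<forall>x\<in>V. p x < t" and le:
    "(\<Sum>x\<in>V. \<Sum>y\<in>V. of_bool (red v x y)) + (\<Sum>x\<in>V. \<Sum>y\<in>V. of_bool (p x = p y \<and> red v x y))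
      \<le> (\<Sum>x\<in>V. \<Sum>y\<in>V. of_bool (p x \<noteq> p y) :: real)"
    using clique_free_partition[OF finite_V link_clique_free[OF v]] red_swap23 red_irrefl by blast
  define a where "a = (\<Sum>w\<in>V. \<Sum>x\<in>V. of_bool (p w = p x) * (1 - blue v w x))"
  have 1: "(\<Sum>x\<in>V. \<Sum>y\<in>V. of_bool (p x = p y \<and> red v x y)) = a"
    unfolding a_def blue_def by (intro sum.cong refl) simp
  have 2: "(\<Sum>x\<in>V. \<Sum>y\<in>V. of_bool (red v x y)) = N\<^sup>2 - (\<Sum>w\<in>V. codeg v w)"
    unfolding codeg_def blue_def of_bool_not_iff N_def
    by (simp only: sum_subtractf) (simp add: power2_eq_square)
  have 3: "(\<Sum>x\<in>V. \<Sum>y\<in>V. of_bool (p x \<noteq> p y) :: real) = N\<^sup>2 - (\<Sum>x\<in>V. \<Sum>y\<in>V. of_bool (p x = p y))"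
    unfolding of_bool_not_iff N_def by (simp only: sum_subtractf) (simp add: power2_eq_square)
  \<comment> \<open>The red pairs inside classes are bounded by the excess of blue pairs over the
    Turan minimum. They enter with weight \<open>3 * N\<close>: \<open>2 * N\<close> from
    \<open>colour_class_ge\<close> and \<open>N\<close> from \<open>colour_class_le\<close>.\<close>
  have "a \<le> (\<Sum>w\<in>V. codeg v w) - N\<^sup>2 / t"
    using le monochromatic_pairs_ge[OF finite_V p] t_ge_2 unfolding 1 2 3 N_def[symmetric] by simp
  then have "3 * N * a \<le> 3 * N * ((\<Sum>w\<in>V. codeg v w) - N\<^sup>2 / t)"
    by (rule mult_left_mono) (simp add: N_def)
  with colour_class_ge[OF p, of v, folded a_def] colour_class_le[of p v, folded a_def]
  show ?thesis by (simp add: algebra_simps)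
qed

text \<open>Sum \<open>link_ge\<close> over \<open>v\<close>. Pairs blue in the links of both
  \<open>v\<close> and \<open>z\<close> become squared codegrees; after exchanging \<open>v\<close>
  and \<open>z\<close>, symmetry of \<open>blue\<close> turns the correction term into
  \<open>open_cherries\<close>.\<close>

lemma codeg_squares_open_cherries_ge:
  "(2 - 1 / t) * N ^ 4 / (real t)\<^sup>2 + 3 * N ^ 4 / t \<le> codeg_squares + open_cherries + 3 * N * blue_triples"
proof -
  have "(\<Sum>v\<in>V. \<Sum>z\<in>V. \<Sum>w\<in>V. \<Sum>x\<in>V. blue v w x * blue z w x) = codeg_squares"
  proof -
    have "(\<Sum>v\<in>V. blue v w x) = codeg w x" for w x
      unfolding codeg_def by (intro sum.cong refl) (metis blue_swap12 blue_swap23)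
    then have sq: "(codeg w x)\<^sup>2 = (\<Sum>v\<in>V. \<Sum>z\<in>V. blue v w x * blue z w x)" for w x
      by (simp add: power2_eq_square sum_product[symmetric])
    have "(\<Sum>v\<in>V. \<Sum>z\<in>V. \<Sum>w\<in>V. \<Sum>x\<in>V. f v z w x) = (\<Sum>w\<in>V. \<Sum>x\<in>V. \<Sum>v\<in>V. \<Sum>z\<in>V. f v z w x)"
      for f :: "'a \<Rightarrow> 'a \<Rightarrow> 'a \<Rightarrow> 'a \<Rightarrow> real"
    proof -
      have "(\<Sum>v\<in>V. \<Sum>z\<in>V. \<Sum>w\<in>V. \<Sum>x\<in>V. f v z w x) = (\<Sum>v\<in>V. \<Sum>w\<in>V. \<Sum>z\<in>V. \<Sum>x\<in>V. f v z w x)"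
        by (intro sum.cong refl sum.swap)
      also have "\<dots> = (\<Sum>w\<in>V. \<Sum>v\<in>V. \<Sum>x\<in>V. \<Sum>z\<in>V. f v z w x)"
        by (subst sum.swap) (intro sum.cong refl sum.swap)
      also have "\<dots> = (\<Sum>w\<in>V. \<Sum>x\<in>V. \<Sum>v\<in>V. \<Sum>z\<in>V. f v z w x)"
        by (intro sum.cong refl sum.swap)
      finally show ?thesis .
    qed
    then show ?thesis unfolding codeg_squares_def sq .
  qed
  moreover have "(\<Sum>v\<in>V. \<Sum>z\<in>V. \<Sum>w\<in>V. \<Sum>x\<in>V. blue v z w * blue v z x * (1 - blue z w x)) = open_cherries"
    unfolding open_cherries_def by (subst sum.swap) (simp only: blue_swap12)
  moreover have "(\<Sum>v\<in>V. (2 - 1 / t) * N ^ 3 / (real t)\<^sup>2 + 3 * N * (N\<^sup>2 / t))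
    \<le> (\<Sum>v\<in>V. (\<Sum>z\<in>V. \<Sum>w\<in>V. \<Sum>x\<in>V. blue v w x * blue z w x)
      + (\<Sum>z\<in>V. \<Sum>w\<in>V. \<Sum>x\<in>V. blue v z w * blue v z x * (1 - blue z w x))
      + 3 * N * (\<Sum>w\<in>V. codeg v w))"
    by (intro sum_mono link_ge)
  moreover have "(\<Sum>v\<in>V. (2 - 1 / t) * N ^ 3 / (real t)\<^sup>2 + 3 * N * (N\<^sup>2 / t))
    = (2 - 1 / t) * N ^ 4 / (real t)\<^sup>2 + 3 * N ^ 4 / t"
    by (simp add: N_def power2_eq_square power3_eq_cube power4_eq_xxxx algebra_simps)
  ultimately show ?thesis
    unfolding sum.distrib sum_distrib_left[symmetric] blue_triples_def[symmetric] by simp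
qed

section \<open>Combining the inequalities into a density bound\<close>

theorem blue_triples_ge: "(1 / t + 1 / (12 * (real t)\<^sup>2)) * N ^ 3 \<le> blue_triples"
proof (cases "V = {}")
  case True
  then have "N = 0" "blue_triples = 0" unfolding N_def blue_triples_def by simp_all
  then show ?thesis by simp
next
  case False
  then have N: "N > 0" using finite_V by (simp add: N_def card_gt_0_iff)
  define s where "s = real t"
  have s: "s \<ge> 2" using t_ge_2 by (simp add: s_def)
  \<comment> \<open>The excess of the blue density over the Turan value \<open>1 / s\<close>; all
    quantities are now normalised.\<close>
  define e where "e = blue_triples / N ^ 3 - 1 / s"
  define q where "q = codeg_squares / N ^ 4"
  define k where "k = open_cherries / N ^ 4"
  have sub: "blue_triples = (1 / s + e) * N ^ 3" "codeg_squares = q * N ^ 4" "open_cherries = k * N ^ 4"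
    using N by (simp_all add: e_def q_def k_def)
  have cancel: "x \<le> y" if "x * N ^ 4 \<le> y * N ^ 4" for x y
    using that N by simp
  have 1: "(s - 1) * k + s * q \<le> (s + 1) * (1 / s + e) - 1"
    by (rule cancel) (use open_cherries_turan[folded s_def, unfolded sub] in
      \<open>simp add: algebra_simps power4_eq_xxxx power3_eq_cube\<close>)
  have 2: "(1 / s + e)\<^sup>2 \<le> q"
    by (rule cancel) (use codeg_squares_ge[of "(1 / s + e) * N", unfolded sub] in
      \<open>simp add: algebra_simps power4_eq_xxxx power3_eq_cube power2_eq_square\<close>)
  have 3: "(2 - 1 / s) / s\<^sup>2 \<le> q + k + 3 * e"
    by (rule cancel) (use codeg_squares_open_cherries_ge[folded s_def, unfolded sub] in
      \<open>simp add: algebra_simps power4_eq_xxxx power3_eq_cube power2_eq_square\<close>)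
  \<comment> \<open>Inserting the lower bound on \<open>q\<close> into the first inequality makes
    the constant terms cancel and leaves \<open>k\<close> at most \<open>e\<close>.\<close>
  have "s * (1 / s + e)\<^sup>2 \<le> s * q" using 2 s by simp
  moreover have "(s + 1) * (1 / s + e) - 1 - s * (1 / s + e)\<^sup>2 = (s - 1) * e - s * e\<^sup>2"
    using s by (simp add: power2_eq_square field_simps)
  moreover have "0 \<le> s * e\<^sup>2" using s by simp
  ultimately have "(s - 1) * k \<le> (s - 1) * e" using 1 by linarith
  then have ke: "k \<le> e" using s by simp
  \<comment> \<open>The factor \<open>s\<close> makes the block \<open>(s - 1) * k + s * q\<close>
    appear, so that the first inequality bounds it as a whole and only one \<open>k\<close> is left
    over.\<close>
  have "s * (2 - 1 / s) / s\<^sup>2 \<le> s * (q + k + 3 * e)"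
    using mult_left_mono[OF 3, of s] s by simp
  also have "\<dots> = ((s - 1) * k + s * q) + k + 3 * s * e" by (simp add: algebra_simps)
  also have "\<dots> \<le> ((s + 1) * (1 / s + e) - 1) + e + 3 * s * e" using 1 ke by linarith
  also have "\<dots> = 1 / s + (4 * s + 2) * e" using s by (simp add: field_simps)
  finally have "s * (2 - 1 / s) / s\<^sup>2 \<le> 1 / s + (4 * s + 2) * e" .
  moreover have "s * (2 - 1 / s) / s\<^sup>2 = 1 / s + (s - 1) / s\<^sup>2"
    using s by (simp add: field_simps power2_eq_square)
  ultimately have "(s - 1) / s\<^sup>2 \<le> (4 * s + 2) * e" by linarith
  \<comment> \<open>The constant 12 is chosen here: \<open>4 * s + 2\<close> is at most
    \<open>12 * (s - 1)\<close> as soon as \<open>s\<close> is at least 7/4, and \<open>s\<close> is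
    at least 2.\<close>
  moreover have "(4 * s + 2) * (1 / (12 * s\<^sup>2)) \<le> (s - 1) / s\<^sup>2"
    using s by (simp add: field_simps)
  ultimately have "(4 * s + 2) * (1 / (12 * s\<^sup>2)) \<le> (4 * s + 2) * e" by linarith
  then have "1 / (12 * s\<^sup>2) \<le> e" using s by (subst (asm) mult_le_cancel_left_pos) auto
  then show ?thesis using N unfolding sub s_def[symmetric] by (intro mult_right_mono) auto
qed

end

section \<open>Turan densities\<close>

lemma finite_ex_num_set:
  "finite {card (edges G) | G :: nat hypergraph. rgraph r G \<and> verts G = {..<n} \<and> free_of \<F> G}"
proof (rule finite_subset)
  show "{card (edges G) | G :: nat hypergraph. rgraph r G \<and> verts G = {..<n} \<and> free_of \<F> G}
    \<subseteq> {..card (Pow {..<n})}"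
  proof
    fix m
    assume "m \<in> {card (edges G) | G :: nat hypergraph. rgraph r G \<and> verts G = {..<n} \<and> free_of \<F> G}"
    then obtain G :: "nat hypergraph" where G: "m = card (edges G)" "rgraph r G" "verts G = {..<n}"
      by blast
    then have "edges G \<subseteq> Pow {..<n}" by (auto simp: rgraph_def)
    then show "m \<in> {..card (Pow {..<n})}"
      unfolding G(1) atMost_iff by (intro card_mono) simp_all
  qed
qed simp

text \<open>Relabelling along a bijection \<open>g\<close> onto \<open>{..<n}\<close>; a forbidden
  copy in the image would pull back to \<open>G\<close> through the inverse of
  \<open>g\<close>.\<close>

lemma card_edges_le_ex_num:
  fixes G :: "'a hypergraph"
  assumes G: "rgraph r G" and n: "card (verts G) = n" and free: "free_of \<F> G"
  shows "card (edges G) \<le> ex_num r n \<F>"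
proof -
  have fin: "finite (verts G)" using G by (simp add: rgraph_def)
  then obtain g where g: "bij_betw g (verts G) {..<n}"
    using ex_bij_betw_finite_nat[OF fin] n atLeast0LessThan by auto
  have inj: "inj_on g (verts G)" and img: "g ` verts G = {..<n}"
    using g by (auto simp: bij_betw_def)
  define H where "H = ({..<n}, (`) g ` edges G)"
  have sub: "e \<subseteq> verts G" "card e = r" if "e \<in> edges G" for e
    using G that by (auto simp: rgraph_def)
  have "rgraph r H"
    unfolding rgraph_def H_def
    using sub fin img[symmetric] by (auto simp: card_image[OF inj_on_subset[OF inj]])
  moreover have "free_of \<F> H"
    unfolding free_of_def
  proof (intro ballI notI)
    fix F assume F: "F \<in> \<F>" and "contains H F"
    then obtain f where f: "inj_on f (verts F)" "f ` verts F \<subseteq> {..<n}"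
      "\<And>e. e \<in> edges F \<Longrightarrow> f ` e \<in> (`) g ` edges G"
      unfolding contains_def H_def by auto
    define h where "h = inv_into (verts G) g \<circ> f"
    have "inj_on h (verts F)"
      unfolding h_def using f(1,2) img
      by (intro comp_inj_on inj_on_inv_into) auto
    moreover have "h ` verts F \<subseteq> verts G"
      unfolding h_def using f(2) img by (auto intro!: inv_into_into)
    moreover have "h ` e \<in> edges G" if e: "e \<in> edges F" for e
    proof -
      obtain e' where e': "e' \<in> edges G" "f ` e = g ` e'" using f(3)[OF e] by auto
      have "h ` e = inv_into (verts G) g ` g ` e'" unfolding h_def image_comp[symmetric] e'(2) ..
      also have "\<dots> = e'" by (rule inv_into_image_cancel[OF inj sub(1)[OF e'(1)]])
      finally show ?thesis using e'(1) by simp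
    qed
    ultimately have "contains G F" unfolding contains_def by blast
    then show False using free F by (auto simp: free_of_def)
  qed
  moreover have "card (edges H) = card (edges G)"
    unfolding H_def snd_conv
    by (rule card_image, rule inj_on_subset[OF inj_on_image_Pow[OF inj]]) (use sub in auto)
  moreover have "verts H = {..<n}" by (simp add: H_def)
  ultimately have "card (edges G) \<in> {card (edges G) | G :: nat hypergraph.
      rgraph r G \<and> verts G = {..<n} \<and> free_of \<F> G}"
    by (intro CollectI exI[of _ H]) simp
  then show ?thesis unfolding ex_num_def by (intro Max_ge finite_ex_num_set)
qed

lemma ex_num_attained:
  assumes "\<And>F. F \<in> \<F> \<Longrightarrow> edges F \<noteq> {}"
  obtains G :: "nat hypergraph"
  where "rgraph r G" "verts G = {..<n}" "free_of \<F> G" "card (edges G) = ex_num r n \<F>"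
proof -
  let ?A = "{card (edges G) | G :: nat hypergraph. rgraph r G \<and> verts G = {..<n} \<and> free_of \<F> G}"
  have "rgraph r ({..<n}, {})" "free_of \<F> ({..<n}, {})"
    using assms by (auto simp: rgraph_def free_of_def contains_def)
  then have "?A \<noteq> {}" by force
  then have "ex_num r n \<F> \<in> ?A" unfolding ex_num_def by (intro Max_in finite_ex_num_set)
  then show ?thesis using that by force
qed

lemma free_of_subgraph:
  assumes "free_of \<F> G" "verts H \<subseteq> verts G" "edges H \<subseteq> edges G"
  shows "free_of \<F> H"
  using assms unfolding free_of_def contains_def by (meson subset_iff)

text \<open>Averaging over vertex deletions: each edge survives the deletion of
  \<open>Suc n - r\<close> vertices, and each remaining hypergraph is free of the family on
  \<open>n\<close> vertices.\<close>

lemma ex_num_Suc_le: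
  assumes "\<And>F. F \<in> \<F> \<Longrightarrow> edges F \<noteq> {}"
  shows "(Suc n - r) * ex_num r (Suc n) \<F> \<le> Suc n * ex_num r n \<F>"
proof -
  obtain G :: "nat hypergraph" where G: "rgraph r G" "verts G = {..<Suc n}" "free_of \<F> G"
    "card (edges G) = ex_num r (Suc n) \<F>"
    using ex_num_attained[OF assms] by blast
  have fin: "finite (edges G)"
    using G(1,2) finite_subset[of "edges G" "Pow {..<Suc n}"] by (auto simp: rgraph_def)
  have "(\<Sum>i<Suc n. card {e\<in>edges G. i \<notin> e}) = (Suc n - r) * card (edges G)"
  proof (rule sum_multicount)
    show "\<forall>e\<in>edges G. card {i\<in>{..<Suc n}. i \<notin> e} = Suc n - r"
    proof
      fix e assume "e \<in> edges G"
      then have e: "e \<subseteq> {..<Suc n}" "card e = r" using G(1,2) by (auto simp: rgraph_def)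
      have "{i\<in>{..<Suc n}. i \<notin> e} = {..<Suc n} - e" by auto
      then show "card {i\<in>{..<Suc n}. i \<notin> e} = Suc n - r"
        using e finite_subset[OF e(1)] by (simp add: card_Diff_subset)
    qed
  qed (use fin in auto)
  moreover have "(\<Sum>i<Suc n. card {e\<in>edges G. i \<notin> e}) \<le> (\<Sum>i<Suc n. ex_num r n \<F>)"
  proof (rule sum_mono)
    fix i assume i: "i \<in> {..<Suc n}"
    let ?H = "({..<Suc n} - {i}, {e\<in>edges G. i \<notin> e})"
    have "rgraph r ?H" using G(1,2) by (auto simp: rgraph_def)
    moreover have "free_of \<F> ?H" by (rule free_of_subgraph[OF G(3)]) (use G(2) in auto)
    ultimately show "card {e\<in>edges G. i \<notin> e} \<le> ex_num r n \<F>"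
      using card_edges_le_ex_num[of r ?H n \<F>] i by simp
  qed
  ultimately show ?thesis using G(4) by simp
qed

text \<open>By averaging, the density decreases from \<open>n = r\<close> on and is bounded below by
  0. This gives meaning to the \<open>lim\<close> in \<open>turan_density\<close>.\<close>

lemma ex_density_convergent:
  assumes "\<And>F. F \<in> \<F> \<Longrightarrow> edges F \<noteq> {}"
  shows "convergent (\<lambda>n. real (ex_num r n \<F>) / real (n choose r))"
proof -
  let ?X = "\<lambda>n. real (ex_num r n \<F>) / real (n choose r)"
  have "?X (Suc n) \<le> ?X n" if "r \<le> n" for n
  proof -
    have pos: "0 < real (n choose r)" "0 < real (Suc n choose r)" "0 < real (Suc n - r)"
      using that by simp_all
    have ch: "real (Suc n - r) * real (Suc n choose r) = real (Suc n) * real (n choose r)"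
      using binomial_absorb_comp[of "Suc n" r] unfolding of_nat_mult[symmetric] by simp
    have le: "real (Suc n - r) * real (ex_num r (Suc n) \<F>) \<le> real (Suc n) * real (ex_num r n \<F>)"
      using ex_num_Suc_le[OF assms, where n = n and r = r] unfolding of_nat_mult[symmetric] of_nat_le_iff .
    have "?X (Suc n) = (real (Suc n - r) * real (ex_num r (Suc n) \<F>))
        / (real (Suc n - r) * real (Suc n choose r))"
      using pos by simp
    also have "\<dots> \<le> (real (Suc n) * real (ex_num r n \<F>)) / (real (Suc n) * real (n choose r))"
      unfolding ch by (rule divide_right_mono[OF le]) simp
    also have "\<dots> = ?X n" by (simp del: of_nat_Suc)
    finally show ?thesis .
  qed
  then have "decseq (\<lambda>n. ?X (n + r))" by (intro decseq_SucI) simp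
  then obtain L where "(\<lambda>n. ?X (n + r)) \<longlonglongrightarrow> L"
    by (rule decseq_convergent[where B = 0]) simp
  then have "?X \<longlonglongrightarrow> L" by (rule LIMSEQ_offset)
  then show ?thesis by (rule convergentI)
qed

section \<open>From daisy-free hypergraphs to triple systems\<close>

lemma daisy_edges_nonempty:
  assumes "t \<ge> 2"
  shows "edges (daisy r t) \<noteq> {}"
proof -
  have "{0, 1} \<in> edges (complete_graph t)" using assms by (auto simp: complete_graph_def)
  then show ?thesis by (auto simp: daisy_def suspension_def)
qed

text \<open>A clique \<open>K\<close> on \<open>t + 1\<close> vertices in the link would complete
  the \<open>r - 2\<close> vertices of \<open>insert v S\<close> to a daisy.\<close>

lemma daisy_free_link:
  assumes G: "rgraph r G" and free: "free_of {daisy r (t + 1)} G"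
    and "r \<ge> 3" "t \<ge> 2" and S: "S \<subseteq> verts G" "card S = r - 3" and v: "v \<in> verts G"
  shows "clique_free (\<lambda>x y. {v, x, y} \<union> S \<in> edges G) (Suc t) (verts G)"
  unfolding clique_free_def
proof
  assume "\<exists>K\<subseteq>verts G. finite K \<and> card K = Suc t \<and>
    (\<forall>x\<in>K. \<forall>y\<in>K. x \<noteq> y \<longrightarrow> {v, x, y} \<union> S \<in> edges G)"
  then obtain K where K: "K \<subseteq> verts G" "finite K" "card K = Suc t"
    "\<And>x y. x \<in> K \<Longrightarrow> y \<in> K \<Longrightarrow> x \<noteq> y \<Longrightarrow> {v, x, y} \<union> S \<in> edges G" by blast
  have finS: "finite S" using S(1) G finite_subset by (auto simp: rgraph_def)
  \<comment> \<open>For a second vertex \<open>y\<close> of \<open>K\<close>, the edge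
    \<open>{v, x, y} \<union> S\<close> has \<open>r\<close> elements while \<open>S\<close> has
    \<open>r - 3\<close>, so \<open>v\<close>, \<open>x\<close>, \<open>y\<close> are distinct and
    outside \<open>S\<close>.\<close>
  have new: "v \<notin> S \<and> x \<notin> insert v S" if x: "x \<in> K" for x
  proof -
    have "K - {x} \<noteq> {}" using K(2,3) assms(4) x
      by (metis card_Diff_singleton card.empty diff_Suc_1 not_numeral_le_zero)
    then obtain y where y: "y \<in> K" "x \<noteq> y" by blast
    have c: "card ({v, x, y} \<union> S) = r"
      using K(4)[OF x y] G by (simp add: rgraph_def)
    have "card {v, x, y} \<le> 3" by (simp add: card_insert_if)
    moreover have "card ({v, x, y} \<union> S) + card ({v, x, y} \<inter> S) = card {v, x, y} + card S"
      using card_Un_Int[of "{v, x, y}" S] finS by simp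
    ultimately have "card ({v, x, y} \<inter> S) = 0" "card {v, x, y} = 3"
      using c S(2) assms(3) by linarith+
    then show ?thesis by (auto simp: card_insert_if split: if_splits)
  qed
  have "K \<noteq> {}" using K(3) by auto
  then have vS: "v \<notin> S" and disj: "K \<inter> insert v S = {}" using new by blast+
  have "card (insert v S) = r - 2" using vS finS S(2) assms(3) by simp
  then obtain sf where sf: "bij_betw sf {..<r - 2} (insert v S)"
    using ex_bij_betw_nat_finite[of "insert v S"] finS atLeast0LessThan by auto
  obtain kf where kf: "bij_betw kf {..<t + 1} K"
    using ex_bij_betw_nat_finite[OF K(2)] K(3) atLeast0LessThan by auto
  define f where "f = case_sum kf sf"
  have fL: "f ` Inl ` A = kf ` A" and fR: "f ` Inr ` B = sf ` B" for A B
    by (auto simp: f_def image_image)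
  have V: "verts (daisy r (t + 1)) = Inl ` {..<t + 1} \<union> Inr ` {..<r - 2}"
    by (simp add: daisy_def suspension_def complete_graph_def)
  have imK: "kf ` {..<t + 1} = K" and imS: "sf ` {..<r - 2} = insert v S"
    using kf sf by (auto simp: bij_betw_def)
  have "inj_on f (verts (daisy r (t + 1)))"
    unfolding V
  proof (rule inj_on_Un[THEN iffD2], intro conjI)
    show "inj_on f (Inl ` {..<t + 1})" "inj_on f (Inr ` {..<r - 2})"
      using kf sf by (auto simp: inj_on_def f_def bij_betw_def)
    have "f ` Inl ` {..<t + 1} \<inter> f ` Inr ` {..<r - 2} = {}"
      unfolding fL fR imK imS by (rule disj)
    then show "f ` (Inl ` {..<t + 1} - Inr ` {..<r - 2}) \<inter> f ` (Inr ` {..<r - 2} - Inl ` {..<t + 1}) = {}"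
      by blast
  qed
  moreover have "f ` verts (daisy r (t + 1)) \<subseteq> verts G"
    unfolding V image_Un fL fR imK imS using K(1) S(1) v by blast
  moreover have "f ` e \<in> edges G" if e: "e \<in> edges (daisy r (t + 1))" for e
  proof -
    obtain d where d: "d \<subseteq> {..<t + 1}" "card d = 2" "e = Inl ` d \<union> Inr ` {..<r - 2}"
      using e by (auto simp: daisy_def suspension_def complete_graph_def)
    obtain i j where ij: "d = {i, j}" "i \<noteq> j" using d(2) by (auto simp: card_2_iff)
    have "kf i \<in> K" "kf j \<in> K" "kf i \<noteq> kf j"
      using ij d(1) kf by (auto simp: bij_betw_def inj_on_def)
    then have "{v, kf i, kf j} \<union> S \<in> edges G" by (rule K(4))
    moreover have "f ` e = {v, kf i, kf j} \<union> S"
      unfolding d(3) image_Un fL fR imS ij(1) by auto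
    ultimately show ?thesis by simp
  qed
  ultimately have "contains G (daisy r (t + 1))" unfolding contains_def by blast
  then show False using free by (simp add: free_of_def)
qed

lemma ordered_triples_ge:
  fixes E :: "'a set set"
  assumes "finite V" and E: "finite E" "\<And>e. e \<in> E \<Longrightarrow> e \<subseteq> V \<and> card e = card S + 3"
    and S: "finite S"
  shows "6 * real (card {e\<in>E. S \<subseteq> e})
    \<le> (\<Sum>a\<in>V. \<Sum>b\<in>V. \<Sum>c\<in>V. of_bool ({a, b, c} \<union> S \<in> E))"
proof -
  define P where "P = {(a, b, c). a \<in> V \<and> b \<in> V \<and> c \<in> V \<and> {a, b, c} \<union> S \<in> E}"
  have PV: "P \<subseteq> V \<times> V \<times> V" by (auto simp: P_def)
  then have finP: "finite P" using assms(1) by (auto intro: finite_subset)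
  have "6 \<le> card {p\<in>P. (case p of (a, b, c) \<Rightarrow> {a, b, c} \<union> S) = e}" if e: "e \<in> E" "S \<subseteq> e" for e
  proof -
    have "card (e - S) = 3" using E(2)[OF e(1)] e(2) S by (simp add: card_Diff_subset)
    then obtain x y z where T: "e - S = {x, y, z}" "x \<noteq> y" "x \<noteq> z" "y \<noteq> z"
      by (auto simp: card_3_iff)
    have eU: "e = {x, y, z} \<union> S" using T(1) e(2) by blast
    have xyz: "x \<in> V" "y \<in> V" "z \<in> V" using E(2)[OF e(1)] eU by auto
    have "6 = card {(x, y, z), (x, z, y), (y, x, z), (y, z, x), (z, x, y), (z, y, x)}"
      using T by simp
    also have "\<dots> \<le> card {p\<in>P. (case p of (a, b, c) \<Rightarrow> {a, b, c} \<union> S) = e}"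
      by (rule card_mono) (use finP e(1) xyz eU in \<open>auto simp: P_def insert_commute\<close>)
    finally show ?thesis .
  qed
  then have "(\<Sum>e\<in>{e\<in>E. S \<subseteq> e}. 6) \<le> (\<Sum>e\<in>{e\<in>E. S \<subseteq> e}.
      card {p\<in>P. (case p of (a, b, c) \<Rightarrow> {a, b, c} \<union> S) = e})"
    by (intro sum_mono) simp
  also have "\<dots> = (\<Sum>e\<in>{e\<in>E. S \<subseteq> e}. \<Sum>p\<in>{p\<in>P. (case p of (a, b, c) \<Rightarrow> {a, b, c} \<union> S) = e}. 1)"
    by simp
  also have "\<dots> = (\<Sum>p\<in>P. 1)"
    by (rule sum.group) (use finP E(1) in \<open>auto simp: P_def\<close>)
  finally have "6 * card {e\<in>E. S \<subseteq> e} \<le> card P" by simp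
  then have "6 * real (card {e\<in>E. S \<subseteq> e}) \<le> real (card P)" by linarith
  also have "real (card P) = (\<Sum>p\<in>V \<times> V \<times> V. of_bool (p \<in> P))"
    using PV assms(1) by (simp add: Int_absorb1)
  also have "\<dots> = (\<Sum>a\<in>V. \<Sum>b\<in>V. \<Sum>c\<in>V. of_bool ((a, b, c) \<in> P))"
    by (simp only: sum.cartesian_product')
  also have "\<dots> = (\<Sum>a\<in>V. \<Sum>b\<in>V. \<Sum>c\<in>V. of_bool ({a, b, c} \<union> S \<in> E))"
    by (intro sum.cong refl) (simp add: P_def)
  finally show ?thesis .
qed

lemma daisy_free_link_card_le:
  assumes G: "rgraph r G" and free: "free_of {daisy r (t + 1)} G"
    and "r \<ge> 3" "t \<ge> 2" and S: "S \<subseteq> verts G" "card S = r - 3"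
  shows "6 * real (card {e\<in>edges G. S \<subseteq> e})
    \<le> (1 - 1 / t - 1 / (12 * (real t)\<^sup>2)) * real (card (verts G)) ^ 3"
proof -
  let ?V = "verts G"
  let ?red = "\<lambda>a b c. {a, b, c} \<union> S \<in> edges G"
  have finV: "finite ?V" and E: "\<And>e. e \<in> edges G \<Longrightarrow> e \<subseteq> ?V \<and> card e = card S + 3"
    using G S(2) assms(3) by (auto simp: rgraph_def)
  have finS: "finite S" using S(1) finV finite_subset by blast
  \<comment> \<open>The system lives on all of \<open>verts G\<close>, including \<open>S\<close>. A
    triple with a repetition or meeting \<open>S\<close> is never red, since its union with
    \<open>S\<close> is smaller than an edge.\<close>
  interpret triple_system ?V ?red t
  proof
    show "\<not> ?red a b b" for a b
    proof
      assume "?red a b b"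
      then have "card ({a, b, b} \<union> S) = card S + 3" using E by blast
      moreover have "card ({a, b, b} \<union> S) \<le> card {a, b, b} + card S" by (rule card_Un_le)
      moreover have "card {a, b, b} \<le> 2" by (simp add: card_insert_if)
      ultimately show False by linarith
    qed
    show "clique_free (?red v) (Suc t) ?V" if "v \<in> ?V" for v
      using daisy_free_link[OF G free assms(3,4) S that] .
  qed (use finV assms(4) in \<open>simp_all add: insert_commute\<close>)
  have "finite (edges G)" using E finV finite_subset[of "edges G" "Pow ?V"] by auto
  then have "6 * real (card {e\<in>edges G. S \<subseteq> e}) \<le> (\<Sum>a\<in>?V. \<Sum>b\<in>?V. \<Sum>c\<in>?V. of_bool (?red a b c))"
    by (intro ordered_triples_ge finV E finS)
  also have "\<dots> = N ^ 3 - blue_triples"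
    unfolding blue_triples_def codeg_def blue_def of_bool_not_iff N_def
    by (simp only: sum_subtractf) (simp add: power3_eq_cube)
  also have "\<dots> \<le> (1 - 1 / t - 1 / (12 * (real t)\<^sup>2)) * N ^ 3"
    using blue_triples_ge by (simp add: algebra_simps)
  finally show ?thesis unfolding N_def .
qed

text \<open>Double counting of pairs of an edge and an \<open>(r - 3)\<close>-subset
  \<open>S\<close> of it, with the link bound applied to each \<open>S\<close>.\<close>

lemma daisy_free_card_le:
  assumes G: "rgraph r G" and free: "free_of {daisy r (t + 1)} G" and "r \<ge> 3" "t \<ge> 2"
    and n: "card (verts G) = n"
  shows "6 * real (r choose 3) * real (card (edges G))
    \<le> real (n choose (r - 3)) * ((1 - 1 / t - 1 / (12 * (real t)\<^sup>2)) * real n ^ 3)"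
proof -
  let ?V = "verts G"
  define Q where "Q = {S. S \<subseteq> ?V \<and> card S = r - 3}"
  have finV: "finite ?V" and E: "\<And>e. e \<in> edges G \<Longrightarrow> e \<subseteq> ?V \<and> card e = r"
    using G by (auto simp: rgraph_def)
  have finE: "finite (edges G)" using E finV finite_subset[of "edges G" "Pow ?V"] by auto
  have finQ: "finite Q" using finV by (auto simp: Q_def)
  have cardQ: "card Q = n choose (r - 3)" unfolding Q_def using n_subsets[OF finV] n by simp
  have "(\<Sum>S\<in>Q. card {e\<in>edges G. S \<subseteq> e}) = (r choose 3) * card (edges G)"
  proof (rule sum_multicount[OF finQ finE])
    show "\<forall>e\<in>edges G. card {S\<in>Q. S \<subseteq> e} = r choose 3"
    proof
      fix e assume "e \<in> edges G"
      then have e: "e \<subseteq> ?V" "card e = r" using E by auto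
      have "{S\<in>Q. S \<subseteq> e} = {S. S \<subseteq> e \<and> card S = r - 3}" using e(1) by (auto simp: Q_def)
      then show "card {S\<in>Q. S \<subseteq> e} = r choose 3"
        using n_subsets[OF finite_subset[OF e(1) finV]] e(2) binomial_symmetric[OF assms(3)] by simp
    qed
  qed
  then have "6 * real (r choose 3) * real (card (edges G))
      = (\<Sum>S\<in>Q. 6 * real (card {e\<in>edges G. S \<subseteq> e}))"
    unfolding sum_distrib_left[symmetric] of_nat_sum[symmetric] by simp
  also have "\<dots> \<le> (\<Sum>S\<in>Q. (1 - 1 / t - 1 / (12 * (real t)\<^sup>2)) * real n ^ 3)"
    unfolding n[symmetric]
    by (intro sum_mono daisy_free_link_card_le[OF G free assms(3,4)]) (auto simp: Q_def)
  finally show ?thesis by (simp add: cardQ)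
qed

section \<open>Passage to the limit\<close>

lemma six_binomial_3: "6 * real ((m + 3) choose 3) = (real m + 1) * (real m + 2) * (real m + 3)"
proof -
  have "fact 3 * real ((m + 3) choose 3) = (\<Prod>i = 0..<3. real (m + 3) - real i)"
    unfolding binomial_gbinomial gbinomial_mult_fact ..
  then show ?thesis by (simp add: fact_numeral numeral_3_eq_3 algebra_simps)
qed

lemma LIMSEQ_shifted_quotient:
  fixes a b :: real
  assumes "b > 0"
  shows "(\<lambda>m. (real m + a) / (real m + b)) \<longlonglongrightarrow> 1"
proof -
  have "filterlim (\<lambda>m. b + real m) at_top sequentially"
    by (rule filterlim_tendsto_add_at_top[OF tendsto_const filterlim_real_sequentially])
  then have "(\<lambda>m. 1 + (a - b) / (b + real m)) \<longlonglongrightarrow> 1 + 0"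
    by (intro tendsto_add tendsto_const tendsto_divide_0[OF tendsto_const]
        filterlim_at_top_imp_at_infinity)
  moreover have "1 + (a - b) / (b + real m) = (real m + a) / (real m + b)" for m
    using assms by (simp add: field_simps add_pos_nonneg less_imp_neq)
  ultimately show ?thesis by simp
qed

theorem theorem1p3:
  fixes r t :: nat
  assumes "r \<ge> 3" and "t \<ge> 2"
  shows "turan_density r {daisy r (t + 1)} \<le> 1 - 1 / real t - 1 / (12 * (real t)\<^sup>2)"
proof -
  let ?F = "{daisy r (t + 1)}"
  let ?c = "1 - 1 / real t - 1 / (12 * (real t)\<^sup>2)"
  let ?X = "\<lambda>n. real (ex_num r n ?F) / real (n choose r)"
  have edge: "edges F \<noteq> {}" if "F \<in> ?F" for F
    using that daisy_edges_nonempty[of "t + 1" r] assms(2) by auto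
  obtain L where L: "?X \<longlonglongrightarrow> L"
    using ex_density_convergent[of ?F r, OF edge] unfolding convergent_def by blast
  have "?X (m + r) \<le> ?c * (real (m + r) ^ 3 / ((real m + 1) * (real m + 2) * (real m + 3)))" for m
  proof -
    let ?n = "m + r"
    obtain G :: "nat hypergraph" where G: "rgraph r G" "verts G = {..<?n}" "free_of ?F G"
      "card (edges G) = ex_num r ?n ?F"
      using ex_num_attained[OF edge] by blast
    have le: "6 * real (r choose 3) * real (ex_num r ?n ?F)
        \<le> real (?n choose (r - 3)) * (?c * real ?n ^ 3)"
      using daisy_free_card_le[OF G(1,3) assms, of ?n] G(2,4) by simp
    \<comment> \<open>Both sides count \<open>(r - 3)\<close>-sets inside \<open>r\<close>-sets.
      Hence the double-counting bound, divided by \<open>?n choose r\<close>, has only the explicit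
      cubic in \<open>m\<close> as denominator.\<close>
    have "(?n choose r) * (r choose (r - 3)) = (?n choose (r - 3)) * ((?n - (r - 3)) choose (r - (r - 3)))"
      by (rule choose_mult) auto
    moreover have "?n - (r - 3) = m + 3" "r - (r - 3) = 3" using assms(1) by auto
    ultimately have "(?n choose r) * (r choose 3) = (?n choose (r - 3)) * ((m + 3) choose 3)"
      using binomial_symmetric[OF assms(1)] by simp
    then have ch: "6 * real (r choose 3) * real (?n choose r)
        = real (?n choose (r - 3)) * ((real m + 1) * (real m + 2) * (real m + 3))"
      unfolding six_binomial_3[symmetric] by (metis (no_types) mult.assoc mult.commute of_nat_mult)
    have pos: "0 < 6 * real (r choose 3)" "0 < real (?n choose (r - 3))"
      using assms(1) by simp_all
    have "?X ?n = (6 * real (r choose 3) * real (ex_num r ?n ?F)) / (6 * real (r choose 3) * real (?n choose r))"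
      using pos(1) by simp
    also have "\<dots> \<le> (real (?n choose (r - 3)) * (?c * real ?n ^ 3)) / (6 * real (r choose 3) * real (?n choose r))"
      by (rule divide_right_mono[OF le]) simp
    also have "\<dots> = ?c * real ?n ^ 3 / ((real m + 1) * (real m + 2) * (real m + 3))"
      unfolding ch using pos(2) by simp
    finally show ?thesis by simp
  qed
  moreover have "(\<lambda>m. (real m + r) / (real m + 1) * ((real m + r) / (real m + 2))
      * ((real m + r) / (real m + 3))) \<longlonglongrightarrow> 1 * 1 * 1"
    by (intro tendsto_mult LIMSEQ_shifted_quotient) simp_all
  then have "(\<lambda>m. real (m + r) ^ 3 / ((real m + 1) * (real m + 2) * (real m + 3))) \<longlonglongrightarrow> 1"
    by (simp add: power3_eq_cube mult.assoc)
  then have "(\<lambda>m. ?c * (real (m + r) ^ 3 / ((real m + 1) * (real m + 2) * (real m + 3)))) \<longlonglongrightarrow> ?c * 1"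
    by (rule tendsto_mult_left)
  ultimately have "L \<le> ?c * 1"
    using LIMSEQ_le[OF LIMSEQ_ignore_initial_segment[OF L, of r]] by blast
  then show ?thesis unfolding turan_density_def using limI[OF L] by simp
qed

end
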